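(* Let $k\ge1$, $d>0$ and $a=\nu_2(d+1)$, the exponent of the largest power of $2$ dividing $d+1$. If $2^a>d$, then $\mathcal D_t(k,d)$ is empty for every $t\ge0$ with $2^t\le d$. Otherwise $$\bigcup_{2^t\le d}\mathcal D_t(k,d)=\mathcal D_a(k,d),\qquad D_k^{\cup}(d):=\Bigl|\bigcup_{2^t\le d}\mathcal D_t(k,d)\Bigr|=\max_{2^t\le d}D_t(k,d).$$ Every total order $\prec$ on the rows of $M(k,d)$ satisfies $D_k^{\cup}(d)\le\lambda_\prec(M(k,d))$.
   Context: $\mathbb N$ includes $0$. $\mathcal P_k=\mathbb F_2[x_1,\dots,x_k]$ with $\deg x_i=1$; $\mathcal P_k^n$ is the degree-$n$ part. For $e\in\mathbb N^k$, $x^e=\prod x_i^{e_i}$, $|e|=\sum e_i$. Steenrod squares act linearly by $\mathrm{Sq}^r(x^a)=\sum_{b\in\mathbb N^k,|b|=r}\prod_i\binom{a_i}{b_i}x^{a+b}$ (mod 2). For $t\ge0$ put $R=2^t$, $m=2R$. For $d\ge R$ write $d=mN+r$ with $0\le r<m$. $\mathcal D_t(k,d)$ is the following set of degree-$d$ monomials in $k$ variables ("targets"): if $r=0$, those all of whose exponents are divisible by $m$; if $0<r<R$, those having one exponent congruent to $r$ modulo $m$ and at least $R$, all other exponents being divisible by $m$; if $r\ge R$, the empty set. For $d<R$, $\mathcal D_t(k,d)=\varnothing$. $D_t(k,d)=|\mathcal D_t(k,d)|$. Unions and maxima over $2^t\le d$ are over integers $t\ge0$ with $2^t\le d$; $D_k^\cup(d)$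 denotes the cardinality of the union in all cases. The hit matrix $M(k,d)$ is the matrix, in monomial bases, of $\bigoplus_{t\ge0,\,2^t\le d}\mathcal P_k^{d-2^t}\to\mathcal P_k^d$, $(g_t)_t\mapsto\sum_t\mathrm{Sq}^{2^t}(g_t)$; its rows are the degree-$d$ monomials. For a total order $\prec$ on rows, $\lambda_\prec(M(k,d))$ is the number of distinct rows that occur as the $\prec$-largest row in the support of a nonzero column. *)

theory Defs
  imports
    "HOL-Library.Poly_Mapping"
    "HOL-Library.Z2"
    "HOL-Computational_Algebra.Primes"
    "HOL-Number_Theory.Cong"
begin

text \<open>
  An exponent vector in \<open>k\<close> variables is a finitely supported map on \<open>nat\<close> whose support
  lies in \<open>{..<k}\<close>; it is identified with the monomial it represents. A polynomial over the
  field with two elements (the type \<open>bit\<close>) is a finitely supported coefficient function on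
  exponent vectors.
\<close>

type_synonym expo = "nat \<Rightarrow>\<^sub>0 nat"
type_synonym poly2 = "expo \<Rightarrow>\<^sub>0 bit"

definition mdeg :: "nat \<Rightarrow> expo \<Rightarrow> nat" where
  "mdeg k e = (\<Sum>i<k. Poly_Mapping.lookup e i)"

definition expos :: "nat \<Rightarrow> nat \<Rightarrow> expo set" where
  "expos k n = {e. Poly_Mapping.keys e \<subseteq> {..<k} \<and> mdeg k e = n}"

definition homog :: "nat \<Rightarrow> nat \<Rightarrow> poly2 set" where
  "homog k n = {f. Poly_Mapping.keys f \<subseteq> expos k n}"

abbreviation mono_poly :: "expo \<Rightarrow> poly2" where
  "mono_poly e \<equiv> Poly_Mapping.single e 1"


subsection \<open>Steenrod squares and the hit matrix\<close>

definition Sq_mono :: "nat \<Rightarrow> nat \<Rightarrow> expo \<Rightarrow> poly2" where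
  "Sq_mono k r a =
     (\<Sum>b\<in>expos k r. Poly_Mapping.single (a + b)
        (of_nat (\<Prod>i<k. Poly_Mapping.lookup a i choose Poly_Mapping.lookup b i)))"

text \<open>
  The linear extension of \<open>Sq_mono\<close>; since the coefficients lie in the field with two elements,
  it is the sum over the monomials that occur.
\<close>

definition Sq :: "nat \<Rightarrow> nat \<Rightarrow> poly2 \<Rightarrow> poly2" where
  "Sq k r f = (\<Sum>a\<in>Poly_Mapping.keys f. Sq_mono k r a)"

text \<open>
  An element of the direct sum of the \<open>homog k (d - 2 ^ t)\<close>, \<open>2 ^ t \<le> d\<close>, is given as a family
  indexed by \<open>t\<close>, of which only the components with \<open>2 ^ t \<le> d\<close> matter.
\<close>

definition hit_map :: "nat \<Rightarrow> nat \<Rightarrow> (nat \<Rightarrow> poly2) \<Rightarrow> poly2" where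
  "hit_map k d g = (\<Sum>t | 2 ^ t \<le> d. Sq k (2 ^ t) (g t))"

lemma lookup_Sq_mono_neq_0:
  assumes "Poly_Mapping.lookup (Sq_mono k r a) p \<noteq> 0"
  shows "\<exists>b\<in>expos k r. p = a + b"
proof (rule ccontr)
  assume "\<not> ?thesis"
  then have "Poly_Mapping.lookup (Sq_mono k r a) p = 0"
    unfolding Sq_mono_def lookup_sum by (intro sum.neutral) (auto simp: lookup_single when_def)
  with assms show False by simp
qed

lemma expos_add:
  assumes "a \<in> expos k m" and "b \<in> expos k n"
  shows "a + b \<in> expos k (m + n)"
  using assms Poly_Mapping.keys_add[of a b]
  by (auto simp: expos_def mdeg_def lookup_add sum.distrib)

lemma Sq_homog:
  assumes "f \<in> homog k n"
  shows "Sq k r f \<in> homog k (n + r)"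
proof -
  have "p \<in> expos k (n + r)" if "Poly_Mapping.lookup (Sq k r f) p \<noteq> 0" for p
  proof -
    from that obtain a where a: "a \<in> Poly_Mapping.keys f"
      and "Poly_Mapping.lookup (Sq_mono k r a) p \<noteq> 0"
      unfolding Sq_def lookup_sum by (meson sum.neutral)
    then obtain b where "b \<in> expos k r" "p = a + b"
      using lookup_Sq_mono_neq_0 by blast
    moreover have "a \<in> expos k n" using a assms by (auto simp: homog_def)
    ultimately show ?thesis by (simp add: expos_add)
  qed
  then show ?thesis by (auto simp: homog_def in_keys_iff)
qed

lemma Sq_conv_lookup:
  assumes "finite A" and "Poly_Mapping.keys f \<subseteq> A"
  shows "Poly_Mapping.lookup (Sq k r f) p =
    (\<Sum>a\<in>A. Poly_Mapping.lookup f a * Poly_Mapping.lookup (Sq_mono k r a) p)"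
proof -
  have "Poly_Mapping.lookup (Sq k r f) p =
    (\<Sum>a\<in>Poly_Mapping.keys f. Poly_Mapping.lookup f a * Poly_Mapping.lookup (Sq_mono k r a) p)"
    unfolding Sq_def lookup_sum by (intro sum.cong) (auto simp: in_keys_iff)
  also have "\<dots> = (\<Sum>a\<in>A. Poly_Mapping.lookup f a * Poly_Mapping.lookup (Sq_mono k r a) p)"
    using assms by (intro sum.mono_neutral_left) (auto simp: in_keys_iff)
  finally show ?thesis .
qed

lemma Sq_add: "Sq k r (f + g) = Sq k r f + Sq k r g"
proof (rule poly_mapping_eqI)
  fix p
  let ?A = "Poly_Mapping.keys f \<union> Poly_Mapping.keys g"
  have "Poly_Mapping.keys (f + g) \<subseteq> ?A" by (rule Poly_Mapping.keys_add)
  then show "Poly_Mapping.lookup (Sq k r (f + g)) p = Poly_Mapping.lookup (Sq k r f + Sq k r g) p"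
    by (simp only: Sq_conv_lookup[where A = ?A] lookup_add sum.distrib distrib_right
          finite_Un finite_keys Un_upper1 Un_upper2 simp_thms)
qed

lemma hit_map_add: "hit_map k d (\<lambda>t. f t + g t) = hit_map k d f + hit_map k d g"
  by (simp add: hit_map_def Sq_add sum.distrib)

lemma hit_map_homog:
  assumes "\<And>t. 2 ^ t \<le> d \<Longrightarrow> g t \<in> homog k (d - 2 ^ t)"
  shows "hit_map k d g \<in> homog k d"
proof -
  have "Sq k (2 ^ t) (g t) \<in> homog k d" if "2 ^ t \<le> d" for t
    using Sq_homog[OF assms[OF that], of "2 ^ t"] that by simp
  then show ?thesis
    unfolding hit_map_def homog_def using keys_sum[of "\<lambda>t. Sq k (2 ^ t) (g t)"] by fastforce
qed

definition hit_rows :: "nat \<Rightarrow> nat \<Rightarrow> expo set" where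
  "hit_rows k d = expos k d"

definition hit_cols :: "nat \<Rightarrow> nat \<Rightarrow> (nat \<times> expo) set" where
  "hit_cols k d = (SIGMA t:{t. 2 ^ t \<le> d}. expos k (d - 2 ^ t))"

definition hit_matrix :: "nat \<Rightarrow> nat \<Rightarrow> expo \<Rightarrow> nat \<times> expo \<Rightarrow> bit" where
  "hit_matrix k d p c =
     Poly_Mapping.lookup (hit_map k d ((\<lambda>_. 0)(fst c := mono_poly (snd c)))) p"

definition col_support :: "'r set \<Rightarrow> ('r \<Rightarrow> 'c \<Rightarrow> bit) \<Rightarrow> 'c \<Rightarrow> 'r set" where
  "col_support R M c = {p \<in> R. M p c \<noteq> 0}"

text \<open>
  Number of rows that are the largest row in the support of some (necessarily nonzero) column of
  the matrix \<open>M\<close> with row set \<open>R\<close> and column set \<open>C\<close>. Here \<open>(q, p) \<in> ord\<close> means that \<open>q\<close> is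
  strictly smaller than \<open>p\<close>.
\<close>

definition leading_count ::
  "('r \<times> 'r) set \<Rightarrow> 'r set \<Rightarrow> 'c set \<Rightarrow> ('r \<Rightarrow> 'c \<Rightarrow> bit) \<Rightarrow> nat" where
  "leading_count ord R C M =
     card {p. \<exists>c\<in>C. p \<in> col_support R M c \<and>
                 (\<forall>q\<in>col_support R M c. q \<noteq> p \<longrightarrow> (q, p) \<in> ord)}"


subsection \<open>Targets\<close>

definition targets :: "nat \<Rightarrow> nat \<Rightarrow> nat \<Rightarrow> expo set" where
  "targets t k d =
     (let R = 2 ^ t; m = 2 * R; r = d mod m in
      if d < R then {}
      else if r = 0 then {e \<in> expos k d. \<forall>i<k. m dvd Poly_Mapping.lookup e i}
      else if r < R then
        {e \<in> expos k d. \<exists>i<k. [Poly_Mapping.lookup e i = r] (mod m) \<and>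
           R \<le> Poly_Mapping.lookup e i \<and>
           (\<forall>j<k. j \<noteq> i \<longrightarrow> m dvd Poly_Mapping.lookup e j)}
      else {})"

definition target_count :: "nat \<Rightarrow> nat \<Rightarrow> nat \<Rightarrow> nat" where
  "target_count t k d = card (targets t k d)"

definition target_union :: "nat \<Rightarrow> nat \<Rightarrow> expo set" where
  "target_union k d = (\<Union>t\<in>{t. 2 ^ t \<le> d}. targets t k d)"

definition target_union_count :: "nat \<Rightarrow> nat \<Rightarrow> nat" where
  "target_union_count k d = card (target_union k d)"

end

theory Submission
  imports Defs
begin

text \<open>
  Every target is the only nonzero entry of some column of the hit matrix, hence the leading row of
  that column for whatever order. Indeed, let \<open>R = 2 ^ t\<close> and \<open>m = 2 * R\<close>, and let \<open>x ^ e\<close> be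
  a target at level \<open>t\<close>. It has a distinguished exponent \<open>e i = m * q + m + r\<close> with \<open>r < R\<close>,
  and \<open>m\<close> divides the other exponents. Lower \<open>e i\<close> by \<open>R\<close> and apply the square of degree
  \<open>R\<close>. An increment \<open>b\<close> with \<open>0 < b \<le> R\<close> of an exponent divisible by \<open>m\<close> has an even binomial
  coefficient, so only the term that puts all of \<open>R\<close> onto position \<open>i\<close> survives; its coefficient
  \<open>(m * q + R + r) choose R\<close> is odd because the bit \<open>t\<close> of the upper number is set. The result
  is exactly \<open>x ^ e\<close> (\<open>Sq_mono_eq_mono_poly\<close>, \<open>hit_column_of_target\<close>). Since this works at all
  levels, the whole union of the target sets consists of leading rows.

  The statements about the union come from the binary expansion of \<open>d\<close>. A target at level \<open>t\<close>
  can exist only if the bit \<open>t\<close> of \<open>d\<close> is zero, so no level below the position \<open>a\<close> of the lowest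
  zero bit has targets (\<open>targets_empty_below_multiplicity\<close>). The conditions at a level \<open>t\<close> above \<open>a\<close>
  imply those at level \<open>a\<close> (\<open>targets_subset_targets_multiplicity\<close>). So level \<open>a\<close> carries the
  union if \<open>2 ^ a \<le> d\<close>; otherwise all admissible levels lie below \<open>a\<close>.
\<close>

section \<open>Binomial coefficients modulo two\<close>

text \<open>
  The absorption identity \<open>b * (n choose b) = n * ((n - 1) choose (b - 1))\<close> makes \<open>2 ^ s\<close> divide
  the left-hand side; if \<open>n choose b\<close> were odd, \<open>2 ^ s\<close> would have to divide \<open>b\<close>.
\<close>

lemma even_choose_pow2_multiple:
  fixes n b s :: nat
  assumes "2 ^ s dvd n" and "0 < b" and "b < 2 ^ s"
  shows "even (n choose b)"
proof (rule ccontr)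
  assume "odd (n choose b)"
  have "b * (n choose b) = n * (n - 1 choose (b - 1))"
    using times_binomial_minus1_eq[of b n] assms(2) by simp
  then have "2 ^ s dvd b * (n choose b)"
    using assms(1) by (metis dvd_mult2)
  moreover have "coprime (2 ^ s) (n choose b)"
    using \<open>odd (n choose b)\<close> by simp
  ultimately have "2 ^ s dvd b"
    by (simp add: coprime_dvd_mult_left_iff)
  with assms(2,3) show False
    by (auto dest: dvd_imp_le)
qed

text \<open>
  The part of Lucas' theorem that is needed here: bits of the upper number from position \<open>s\<close> on
  do not matter if the lower number is less than \<open>2 ^ s\<close>. In Vandermonde's convolution all terms but
  the one with \<open>j = 0\<close> are even.
\<close>

lemma even_choose_add_pow2_multiple_iff:
  fixes n c b s :: nat
  assumes "2 ^ s dvd c" and "b < 2 ^ s"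
  shows "even ((c + n) choose b) \<longleftrightarrow> even (n choose b)"
proof -
  have "((c + n) choose b) = (\<Sum>j\<le>b. (c choose j) * (n choose (b - j)))"
    by (rule vandermonde[symmetric])
  also have "\<dots> = (n choose b) + (\<Sum>j\<in>{..b} - {0}. (c choose j) * (n choose (b - j)))"
    by (subst sum.remove[of _ 0]) auto
  finally have "((c + n) choose b) = \<dots>" .
  moreover have "even (\<Sum>j\<in>{..b} - {0}. (c choose j) * (n choose (b - j)))"
    using assms by (intro dvd_sum dvd_mult2 even_choose_pow2_multiple[of s]) auto
  ultimately show ?thesis by simp
qed

lemma odd_choose_pow2:
  fixes c r t :: nat
  assumes "2 * 2 ^ t dvd c" and "r < 2 ^ t"
  shows "odd ((c + (2 ^ t + r)) choose 2 ^ t)"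
proof -
  have "even ((c + (2 ^ t + r)) choose 2 ^ t) \<longleftrightarrow> even ((2 ^ t + r) choose 2 ^ t)"
    using assms(1) by (intro even_choose_add_pow2_multiple_iff[of "Suc t"]) auto
  \<comment> \<open>The lower number \<open>2 ^ t\<close> is too large to drop the summand \<open>2 ^ t\<close>; its complement \<open>r\<close> is not.\<close>
  also have "(2 ^ t + r) choose 2 ^ t = (2 ^ t + r) choose r"
    by (subst binomial_symmetric) auto
  also have "even \<dots> \<longleftrightarrow> even (r choose r)"
    using assms(2) by (intro even_choose_add_pow2_multiple_iff[of t]) auto
  finally show ?thesis by simp
qed


section \<open>Columns with a single entry\<close>

lemma finite_expos: "finite (expos k n)"
proof -
  let ?F = "{f. \<forall>i. (i \<in> {..<k} \<longrightarrow> f i \<in> {..n}) \<and> (i \<notin> {..<k} \<longrightarrow> f i = (0::nat))}"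
  have "Poly_Mapping.lookup e \<in> ?F" if "e \<in> expos k n" for e
  proof -
    have "Poly_Mapping.lookup e i \<le> n" if "i < k" for i
      using \<open>e \<in> expos k n\<close> that member_le_sum[of i "{..<k}" "Poly_Mapping.lookup e"]
      by (auto simp: expos_def mdeg_def)
    moreover have "Poly_Mapping.lookup e i = 0" if "i \<notin> {..<k}" for i
      using \<open>e \<in> expos k n\<close> that by (auto simp: expos_def in_keys_iff)
    ultimately show ?thesis by auto
  qed
  then have "Poly_Mapping.lookup ` expos k n \<subseteq> ?F"
    by (rule image_subsetI)
  moreover have "finite ?F"
    by (rule finite_set_of_finite_funs) auto
  ultimately have "finite (Poly_Mapping.lookup ` expos k n)"
    by (rule finite_subset)
  then show ?thesis
    by (rule finite_imageD) (simp add: inj_on_def poly_mapping_eqI)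
qed

lemma of_nat_bit_eq_0_iff: "(of_nat n :: bit) = 0 \<longleftrightarrow> even n"
  by (induction n) auto

lemma Sq_mono_poly: "Sq k r (mono_poly e) = Sq_mono k r e"
  by (simp add: Sq_def)

text \<open>
  An increment \<open>b\<close> other than the whole of \<open>2 ^ t\<close> at position \<open>i\<close> is positive, and at most \<open>2 ^ t\<close>,
  at some other position, where the exponent is divisible by \<open>2 * 2 ^ t\<close>; this makes its coefficient
  even.
\<close>

lemma Sq_mono_eq_mono_poly:
  fixes k t i r :: nat and c :: expo
  assumes "i < k" and c: "\<And>j. j < k \<Longrightarrow> 2 * 2 ^ t dvd Poly_Mapping.lookup c j"
    and r: "r < 2 ^ t"
  shows "Sq_mono k (2 ^ t) (c + Poly_Mapping.single i (2 ^ t + r)) =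
           mono_poly (c + Poly_Mapping.single i (2 * 2 ^ t + r))"
proof -
  let ?a = "c + Poly_Mapping.single i (2 ^ t + r)"
  let ?s = "Poly_Mapping.single i (2 ^ t) :: expo"
  let ?C = "\<lambda>b. \<Prod>j<k. Poly_Mapping.lookup ?a j choose Poly_Mapping.lookup b j"
  have s: "?s \<in> expos k (2 ^ t)"
    using \<open>i < k\<close> by (auto simp: expos_def mdeg_def lookup_single when_def sum.delta)
  have "even (?C b)" if b: "b \<in> expos k (2 ^ t)" "b \<noteq> ?s" for b
  proof -
    have sum_b: "(\<Sum>j<k. Poly_Mapping.lookup b j) = 2 ^ t"
      and keys_b: "Poly_Mapping.keys b \<subseteq> {..<k}"
      using b(1) by (auto simp: expos_def mdeg_def)
    have "\<exists>j<k. j \<noteq> i \<and> Poly_Mapping.lookup b j \<noteq> 0"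
    proof (rule ccontr)
      assume "\<not> ?thesis"
      then have zero: "Poly_Mapping.lookup b j = 0" if "j \<noteq> i" for j
        using keys_b that by (cases "j < k") (auto simp: in_keys_iff)
      have "(\<Sum>j<k. Poly_Mapping.lookup b j) = (\<Sum>j\<in>{i}. Poly_Mapping.lookup b j)"
        using \<open>i < k\<close> zero by (intro sum.mono_neutral_right) auto
      then have "b = ?s"
        using sum_b zero by (intro poly_mapping_eqI) (auto simp: lookup_single when_def)
      with b(2) show False by blast
    qed
    then obtain j where j: "j < k" "j \<noteq> i" "Poly_Mapping.lookup b j \<noteq> 0" by blast
    have "Poly_Mapping.lookup b j \<le> 2 ^ t"
      using member_le_sum[of j "{..<k}" "Poly_Mapping.lookup b"] j(1) sum_b by auto
    then have "Poly_Mapping.lookup b j < 2 ^ Suc t"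
      by (rule le_less_trans) simp
    then have "even (Poly_Mapping.lookup ?a j choose Poly_Mapping.lookup b j)"
      using j c[of j]
      by (intro even_choose_pow2_multiple[of "Suc t"]) (auto simp: lookup_add lookup_single)
    then show ?thesis
      using j(1) by (auto simp: prime_dvd_prod_iff two_is_prime_nat)
  qed
  then have "Poly_Mapping.single (?a + b) (of_nat (?C b) :: bit) = 0"
    if "b \<in> expos k (2 ^ t) - {?s}" for b
    using that of_nat_bit_eq_0_iff[of "?C b"] by (metis DiffE singletonI single_zero)
  then have "Sq_mono k (2 ^ t) ?a =
      (\<Sum>b\<in>{?s}. Poly_Mapping.single (?a + b) (of_nat (?C b)))"
    unfolding Sq_mono_def using s finite_expos[of k "2 ^ t"]
    by (intro sum.mono_neutral_right ballI) simp_all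
  moreover have "odd (?C ?s)"
  proof -
    have "odd (Poly_Mapping.lookup ?a j choose Poly_Mapping.lookup ?s j)" if "j < k" for j
      using odd_choose_pow2[OF c[OF \<open>i < k\<close>] r]
      by (cases "j = i") (auto simp: lookup_add lookup_single)
    then show ?thesis
      by (auto simp: prime_dvd_prod_iff two_is_prime_nat)
  qed
  then have "(of_nat (?C ?s) :: bit) = 1"
    using of_nat_bit_eq_0_iff[of "?C ?s"] by (cases "of_nat (?C ?s) :: bit") auto
  moreover have "?a + ?s = c + Poly_Mapping.single i (2 * 2 ^ t + r)"
    by (simp add: add.assoc Poly_Mapping.single_add[symmetric] ac_simps mult_2)
  ultimately show ?thesis by (simp del: of_nat_prod)
qed

lemma finite_pow2_le: "finite {t::nat. 2 ^ t \<le> (d::nat)}"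
proof (rule finite_subset)
  show "{t. 2 ^ t \<le> d} \<subseteq> {..d}"
  proof
    fix t assume "t \<in> {t. 2 ^ t \<le> d}"
    then have "t < d"
      using less_le_trans[OF less_exp[of t], of d] by simp
    then show "t \<in> {..d}" by simp
  qed
qed simp

lemma hit_map_single:
  assumes "2 ^ t \<le> d"
  shows "hit_map k d ((\<lambda>_. 0)(t := f)) = Sq k (2 ^ t) f"
proof -
  have "hit_map k d ((\<lambda>_. 0)(t := f)) = (\<Sum>s\<in>{t}. Sq k (2 ^ s) (((\<lambda>_. 0)(t := f)) s))"
    unfolding hit_map_def using assms finite_pow2_le
    by (intro sum.mono_neutral_right) (auto simp: Sq_def)
  then show ?thesis by simp
qed

lemma mdeg_add: "mdeg k (a + b) = mdeg k a + mdeg k b"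
  by (simp add: mdeg_def lookup_add sum.distrib)

lemma mdeg_single: "i < k \<Longrightarrow> mdeg k (Poly_Mapping.single i n) = n"
  by (simp add: mdeg_def lookup_single when_def sum.delta)


section \<open>Targets as leading rows\<close>

text \<open>
  The two kinds of targets have one common description: if the residue is zero, any nonzero exponent
  serves as the distinguished one, being a positive multiple of \<open>2 * 2 ^ t\<close>; such an exponent exists
  since \<open>d\<close> is positive.
\<close>

lemma targets_distinguished_index:
  assumes e: "e \<in> targets t k d"
  obtains i where "i < k" "d mod (2 * 2 ^ t) < 2 ^ t" "2 ^ t \<le> d"
    "[Poly_Mapping.lookup e i = d mod (2 * 2 ^ t)] (mod (2 * 2 ^ t))"
    "2 ^ t \<le> Poly_Mapping.lookup e i" "e \<in> expos k d"
    "\<And>j. j < k \<Longrightarrow> j \<noteq> i \<Longrightarrow> 2 * 2 ^ t dvd Poly_Mapping.lookup e j"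
proof (cases "d mod (2 * 2 ^ t) = 0")
  case True
  then have e': "2 ^ t \<le> d" "e \<in> expos k d"
      "\<And>j. j < k \<Longrightarrow> 2 * 2 ^ t dvd Poly_Mapping.lookup e j"
    using e by (auto simp: targets_def Let_def split: if_splits)
  have "\<exists>i<k. Poly_Mapping.lookup e i \<noteq> 0"
  proof (rule ccontr)
    assume "\<not> ?thesis"
    then have "d = 0" using e'(2) by (auto simp: expos_def mdeg_def)
    with e'(1) show False by simp
  qed
  then obtain i where i: "i < k" "Poly_Mapping.lookup e i \<noteq> 0" by blast
  then have "2 * 2 ^ t \<le> Poly_Mapping.lookup e i"
    using e'(3)[OF i(1)] by (auto dest: dvd_imp_le)
  with i e' True show thesis
    by (intro that[of i]) (auto simp: cong_0_iff)
next
  case False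
  with e show thesis
    by (auto simp: targets_def Let_def split: if_splits intro: that)
qed

text \<open>
  The column is indexed by the target with its distinguished exponent lowered by \<open>2 ^ t\<close>.
\<close>

lemma hit_column_of_target:
  assumes "e \<in> targets t k d"
  obtains u where "(t, u) \<in> hit_cols k d"
    "col_support (hit_rows k d) (hit_matrix k d) (t, u) = {e}"
proof -
  define r where "r = d mod (2 * 2 ^ t)"
  obtain i where i: "i < k" "r < 2 ^ t" "2 ^ t \<le> d"
    "[Poly_Mapping.lookup e i = r] (mod (2 * 2 ^ t))"
    "2 ^ t \<le> Poly_Mapping.lookup e i" and e: "e \<in> expos k d"
    and others: "\<And>j. j < k \<Longrightarrow> j \<noteq> i \<Longrightarrow> 2 * 2 ^ t dvd Poly_Mapping.lookup e j"
    using targets_distinguished_index[OF assms, folded r_def] by blast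
  \<comment> \<open>As \<open>r < 2 ^ t \<le> e i\<close>, the distinguished exponent exceeds its residue by at least one period.\<close>
  have "Poly_Mapping.lookup e i mod (2 * 2 ^ t) = r"
    using i(2,4) by (simp add: cong_def)
  then have ei: "Poly_Mapping.lookup e i = 2 * 2 ^ t * (Poly_Mapping.lookup e i div (2 * 2 ^ t)) + r"
    by (metis mult_div_mod_eq)
  then have "Poly_Mapping.lookup e i div (2 * 2 ^ t) \<noteq> 0"
    using i(2,5) by (intro notI) simp
  then obtain q where "Poly_Mapping.lookup e i div (2 * 2 ^ t) = Suc q"
    using not0_implies_Suc by blast
  with ei have ei: "Poly_Mapping.lookup e i = 2 * 2 ^ t * q + (2 * 2 ^ t + r)"
    by simp
  define c :: expo where "c = Poly_Mapping.update i (2 * 2 ^ t * q) e"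
  define u where "u = c + Poly_Mapping.single i (2 ^ t + r)"
  have lookup_c: "Poly_Mapping.lookup c j = (if j = i then 2 * 2 ^ t * q else Poly_Mapping.lookup e j)"
    for j by (simp add: c_def lookup_update)
  have e_eq: "e = c + Poly_Mapping.single i (2 * 2 ^ t + r)"
    by (rule poly_mapping_eqI) (auto simp: lookup_add lookup_single lookup_c ei when_def)
  have Sq_u: "Sq_mono k (2 ^ t) u = mono_poly e"
    unfolding u_def e_eq using i(1,2) others
    by (intro Sq_mono_eq_mono_poly) (auto simp: lookup_c)
  have "mdeg k e = mdeg k u + 2 ^ t"
    using i(1) by (simp add: e_eq u_def mdeg_add mdeg_single)
  then have "u \<in> expos k (d - 2 ^ t)"
    using e i(1) by (auto simp: expos_def in_keys_iff u_def lookup_add lookup_single lookup_c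
        when_def subset_iff split: if_splits)
  then have "(t, u) \<in> hit_cols k d"
    using i(3) by (simp add: hit_cols_def)
  moreover have "col_support (hit_rows k d) (hit_matrix k d) (t, u) = {e}"
    using e i(3)
    by (auto simp: col_support_def hit_rows_def hit_matrix_def hit_map_single Sq_mono_poly Sq_u
        lookup_single when_def)
  ultimately show thesis by (rule that)
qed

lemma target_union_count_le_leading_count:
  "target_union_count k d \<le> leading_count ord (hit_rows k d) (hit_cols k d) (hit_matrix k d)"
proof -
  let ?L = "{p. \<exists>c\<in>hit_cols k d. p \<in> col_support (hit_rows k d) (hit_matrix k d) c \<and>
      (\<forall>q\<in>col_support (hit_rows k d) (hit_matrix k d) c. q \<noteq> p \<longrightarrow> (q, p) \<in> ord)}"
  have "?L \<subseteq> expos k d" by (auto simp: col_support_def hit_rows_def)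
  then have "finite ?L" using finite_expos by (rule finite_subset)
  moreover have "target_union k d \<subseteq> ?L"
  proof
    fix e assume "e \<in> target_union k d"
    then obtain t where "e \<in> targets t k d" by (auto simp: target_union_def)
    then obtain u where "(t, u) \<in> hit_cols k d"
      "col_support (hit_rows k d) (hit_matrix k d) (t, u) = {e}"
      by (rule hit_column_of_target)
    then show "e \<in> ?L" by (auto intro!: bexI[of _ "(t, u)"])
  qed
  ultimately show ?thesis
    unfolding target_union_count_def leading_count_def by (rule card_mono)
qed

section \<open>Comparing the target sets\<close>

text \<open>
  The number \<open>a\<close> is the number of trailing ones in the binary expansion of \<open>d\<close>: the bits below \<open>a\<close>
  are one and the bit \<open>a\<close> is zero.
\<close>

lemma mod_pow2_eq_pred_pow2:
  fixes d :: nat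
  defines "a \<equiv> multiplicity 2 (d + 1)"
  shows "d mod (2 * 2 ^ a) = 2 ^ a - 1"
proof -
  obtain q where q: "d + 1 = 2 ^ a * q" "odd q"
    using multiplicity_decompose'[of "d + 1" "2::nat"] unfolding a_def by auto
  then obtain p where "q = 2 * p + 1" by (auto elim: oddE)
  with q(1) have "d + 1 = 2 * 2 ^ a * p + 2 ^ a" by (simp add: algebra_simps)
  then have "d = (2 ^ a - 1) + (2 * 2 ^ a) * p" by simp
  then have "d mod (2 * 2 ^ a) = ((2 ^ a - 1) + (2 * 2 ^ a) * p) mod (2 * 2 ^ a)"
    by (rule arg_cong)
  also have "\<dots> = (2 ^ a - 1) mod (2 * 2 ^ a)"
    by (rule mod_mult_self2)
  also have "\<dots> = 2 ^ a - 1"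
    by (rule mod_less) (simp add: less_imp_diff_less)
  finally show ?thesis .
qed

text \<open>
  Targets at level \<open>t\<close> require the bit \<open>t\<close> of \<open>d\<close> to be zero, but \<open>t\<close> is the position of one of
  the trailing ones.
\<close>

lemma targets_empty_below_multiplicity:
  assumes "t < multiplicity 2 (d + 1)"
  shows "targets t k d = {}"
proof -
  have "(2::nat) ^ Suc t dvd d + 1"
    using assms by (intro multiplicity_dvd') simp
  then obtain q where q: "d + 1 = 2 * 2 ^ t * q" by (auto elim: dvdE)
  then obtain p where "q = Suc p" by (cases q) auto
  with q have "d = (2 * 2 ^ t - 1) + (2 * 2 ^ t) * p" by simp
  then have "d mod (2 * 2 ^ t) = ((2 * 2 ^ t - 1) + (2 * 2 ^ t) * p) mod (2 * 2 ^ t)"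
    by (rule arg_cong)
  also have "\<dots> = (2 * 2 ^ t - 1) mod (2 * 2 ^ t)"
    by (rule mod_mult_self2)
  finally have "d mod (2 * 2 ^ t) = 2 * 2 ^ t - 1" by simp
  then have "\<not> d mod (2 * 2 ^ t) < 2 ^ t"
    using one_le_power[of "2::nat" t] by linarith
  then show ?thesis
    using targets_distinguished_index by (metis all_not_in_conv)
qed

lemma targetsI_nonzero_residue:
  assumes "0 < d mod (2 * 2 ^ t)" "d mod (2 * 2 ^ t) < 2 ^ t" "2 ^ t \<le> d"
    and "i < k" "e \<in> expos k d"
    and "[Poly_Mapping.lookup e i = d mod (2 * 2 ^ t)] (mod (2 * 2 ^ t))"
    and "2 ^ t \<le> Poly_Mapping.lookup e i"
    and "\<And>j. j < k \<Longrightarrow> j \<noteq> i \<Longrightarrow> 2 * 2 ^ t dvd Poly_Mapping.lookup e j"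
  shows "e \<in> targets t k d"
proof -
  define r where "r = d mod (2 * 2 ^ t)"
  have r: "r \<noteq> 0" "r < 2 ^ t" "\<not> d < 2 ^ t"
    using assms(1-3) unfolding r_def by linarith+
  have "targets t k d = {e \<in> expos k d. \<exists>i<k. [Poly_Mapping.lookup e i = r] (mod (2 * 2 ^ t)) \<and>
      2 ^ t \<le> Poly_Mapping.lookup e i \<and>
      (\<forall>j<k. j \<noteq> i \<longrightarrow> 2 * 2 ^ t dvd Poly_Mapping.lookup e j)}"
    unfolding targets_def Let_def r_def[symmetric] by (simp only: r if_True if_False)
  with assms(4-8) show ?thesis
    unfolding r_def[symmetric] by blast
qed

text \<open>
  Going down from \<open>t\<close> to \<open>a\<close> weakens every condition: divisibility by \<open>2 * 2 ^ t\<close> implies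
  divisibility by \<open>2 * 2 ^ a\<close>, the lower bound \<open>2 ^ t\<close> on the distinguished exponent implies the
  bound \<open>2 ^ a\<close>, and that exponent stays congruent to \<open>d\<close> modulo the smaller power. What remains is that
  the residue of \<open>d\<close> modulo \<open>2 * 2 ^ a\<close> falls into one of the two cases that admit targets.
\<close>

lemma targets_subset_targets_multiplicity:
  fixes d :: nat
  defines "a \<equiv> multiplicity 2 (d + 1)"
  assumes "a \<le> t"
  shows "targets t k d \<subseteq> targets a k d"
proof
  fix e assume et: "e \<in> targets t k d"
  obtain i where i: "i < k" "2 ^ t \<le> d"
    "[Poly_Mapping.lookup e i = d mod (2 * 2 ^ t)] (mod (2 * 2 ^ t))"
    "2 ^ t \<le> Poly_Mapping.lookup e i" and e: "e \<in> expos k d"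
    and others: "\<And>j. j < k \<Longrightarrow> j \<noteq> i \<Longrightarrow> 2 * 2 ^ t dvd Poly_Mapping.lookup e j"
    using targets_distinguished_index[OF et] by blast
  have le: "(2::nat) ^ a \<le> 2 ^ t" and dvd: "2 * (2::nat) ^ a dvd 2 * 2 ^ t"
    using \<open>a \<le> t\<close> by (auto simp: le_imp_power_dvd)
  have r: "d mod (2 * 2 ^ a) = 2 ^ a - 1"
    unfolding a_def by (rule mod_pow2_eq_pred_pow2)
  have "[Poly_Mapping.lookup e i = d] (mod (2 * 2 ^ t))"
    using i(3) by (simp add: cong_def)
  then have ei: "[Poly_Mapping.lookup e i = d] (mod (2 * 2 ^ a))"
    using dvd cong_dvd_modulus_nat by blast
  have others': "2 * 2 ^ a dvd Poly_Mapping.lookup e j" if "j < k" "j \<noteq> i" for j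
    using others[OF that] dvd dvd_trans by blast
  show "e \<in> targets a k d"
  proof (cases "a = 0")
    case True
    then have "2 dvd Poly_Mapping.lookup e j" if "j < k" for j
      using ei r others' that by (cases "j = i") (auto simp: cong_def dvd_eq_mod_eq_0)
    moreover have "0 < d"
      by (rule less_le_trans[OF _ i(2)]) simp
    ultimately show ?thesis
      using True r e by (auto simp: targets_def Let_def)
  next
    case False
    then have "(2::nat) \<le> 2 ^ a" using power_increasing[of 1 a "2::nat"] by simp
    with r have "0 < d mod (2 * 2 ^ a)" "d mod (2 * 2 ^ a) < 2 ^ a" by linarith+
    moreover have "[Poly_Mapping.lookup e i = d mod (2 * 2 ^ a)] (mod (2 * 2 ^ a))"
      using ei by (simp add: cong_def)
    moreover have "2 ^ a \<le> d" "2 ^ a \<le> Poly_Mapping.lookup e i"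
      using i(2,4) le by linarith+
    ultimately show ?thesis
      using i(1) e others' by (intro targetsI_nonzero_residue[of d a i k])
  qed
qed

lemma finite_targets: "finite (targets t k d)"
  by (rule finite_subset[OF _ finite_expos[of k d]]) (auto simp: targets_def Let_def)

theorem proposition4p2:
  fixes k d a :: nat
  assumes "k \<ge> 1" and "d > 0" and "a = multiplicity 2 (d + 1)"
  shows "(2 ^ a > d \<longrightarrow> (\<forall>t. 2 ^ t \<le> d \<longrightarrow> targets t k d = {})) \<and>
         (\<not> 2 ^ a > d \<longrightarrow>
            target_union k d = targets a k d \<and>
            target_union_count k d = Max {target_count t k d | t. 2 ^ t \<le> d}) \<and>
         (\<forall>ord. ord \<subseteq> hit_rows k d \<times> hit_rows k d \<and> strict_linear_order_on (hit_rows k d) ord \<longrightarrow>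
            target_union_count k d
              \<le> leading_count ord (hit_rows k d) (hit_cols k d) (hit_matrix k d))"
proof (intro conjI impI allI)
  fix t :: nat
  assume "2 ^ a > d" and "2 ^ t \<le> d"
  then have "(2::nat) ^ t < 2 ^ a" by linarith
  then have "t < a" by simp
  then show "targets t k d = {}"
    using assms(3) targets_empty_below_multiplicity by blast
next
  assume "\<not> 2 ^ a > d"
  then have a_le: "2 ^ a \<le> d" by simp
  have sub: "targets t k d \<subseteq> targets a k d" for t
    using targets_empty_below_multiplicity[of t d k]
      targets_subset_targets_multiplicity[of d t k] assms(3) by (cases "t < a") auto
  then show union: "target_union k d = targets a k d"
    using a_le by (auto simp: target_union_def)
  have "Max {target_count t k d | t. 2 ^ t \<le> d} = target_count a k d"
  proof (rule Max_eqI)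
    show "finite {target_count t k d | t. 2 ^ t \<le> d}"
      using finite_pow2_le[of d] by simp
  qed (use a_le sub finite_targets in \<open>auto simp: target_count_def card_mono\<close>)
  then show "target_union_count k d = Max {target_count t k d | t. 2 ^ t \<le> d}"
    by (simp add: target_union_count_def union target_count_def)
qed (rule target_union_count_le_leading_count)

end
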